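(* Let $\mathcal{B}$ be a bounding family on $[n]^d$ and $\varepsilon>0$. There is a distribution-free, non-adaptive, one-sided error tester for $\mathcal{P}(\mathcal{B})$ (functions $f:[n]^d\to\mathbb{R}$) with respect to an unknown product distribution $\mathcal{D}$ on $[n]^d$ with proximity parameter $\varepsilon$, making $100\,\varepsilon^{-1}d\log n$ queries.
   Context: A bounding family is a tuple of $2d$ functions $l_1,u_1,\dots,l_d,u_d:[n-1]\to\mathbb{R}$ with $l_r(y)<u_r(y)$. $\mathcal{P}(\mathcal{B})$ is the set of $f:[n]^d\to\mathbb{R}$ with $l_r(x_r)\le f(x+\mathbf{e}_r)-f(x)\le u_r(x_r)$ for all $r$ and $x$ with $x_r<n$. $\mathrm{dist}_{\mathcal{D}}(f,\mathcal{P})=\inf_{g\in\mathcal{P}}\Pr_{x\sim\mathcal{D}}[f(x)\ne g(x)]$. A distribution-free tester does not know $\mathcal{D}$ but can draw independent samples from $\mathcal{D}$ and query $f$ at any point of $[n]^d$; it must accept with probability $>2/3$ if $f\in\mathcal{P}(\mathcal{B})$ and reject with probability $>2/3$ if $\mathrm{dist}_{\mathcal{D}}(f,\mathcal{P}(\mathcal{B}))>\varepsilon$. Non-adaptive: queries do not depend on answers; one-sided: functions in the property are always accepted. *)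

theory Defs
  imports "HOL-Probability.Probability"
begin

definition grid :: "nat \<Rightarrow> nat \<Rightarrow> nat list set" where
  "grid n d = {x. length x = d \<and> (\<forall>i<d. 1 \<le> x ! i \<and> x ! i \<le> n)}"

definition step :: "nat list \<Rightarrow> nat \<Rightarrow> nat list" where
  "step x r = x[r := x ! r + 1]"

definition bounding_family :: "nat \<Rightarrow> nat \<Rightarrow> (nat \<Rightarrow> nat \<Rightarrow> real) \<Rightarrow> (nat \<Rightarrow> nat \<Rightarrow> real) \<Rightarrow> bool" where
  "bounding_family n d l u \<longleftrightarrow> (\<forall>r<d. \<forall>y\<in>{1..n-1}. l r y < u r y)"

definition prop_B :: "nat \<Rightarrow> nat \<Rightarrow> (nat \<Rightarrow> nat \<Rightarrow> real) \<Rightarrow> (nat \<Rightarrow> nat \<Rightarrow> real) \<Rightarrow> (nat list \<Rightarrow> real) set" where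
  "prop_B n d l u = {f. \<forall>x\<in>grid n d. \<forall>r<d. x ! r < n \<longrightarrow>
      l r (x ! r) \<le> f (step x r) - f x \<and> f (step x r) - f x \<le> u r (x ! r)}"

fun prod_list_pmf :: "'a pmf list \<Rightarrow> 'a list pmf" where
  "prod_list_pmf [] = return_pmf []"
| "prod_list_pmf (\<mu> # \<mu>s) = bind_pmf \<mu> (\<lambda>x. map_pmf (\<lambda>xs. x # xs) (prod_list_pmf \<mu>s))"

definition product_distribution :: "nat \<Rightarrow> nat \<Rightarrow> nat list pmf \<Rightarrow> bool" where
  "product_distribution n d D \<longleftrightarrow>
     (\<exists>\<mu>s. length \<mu>s = d \<and> (\<forall>i<d. set_pmf (\<mu>s ! i) \<subseteq> {1..n}) \<and> D = prod_list_pmf \<mu>s)"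

definition iid_pmf :: "nat \<Rightarrow> 'a pmf \<Rightarrow> 'a list pmf" where
  "iid_pmf m D = prod_list_pmf (replicate m D)"

definition dist_D :: "nat list pmf \<Rightarrow> (nat list \<Rightarrow> real) \<Rightarrow> (nat list \<Rightarrow> real) set \<Rightarrow> real" where
  "dist_D D f P = Inf ((\<lambda>g. measure_pmf.prob D {x. f x \<noteq> g x}) ` P)"

text \<open>A non-adaptive distribution-free tester is given by: a number m of samples,
  a distribution R of internal random coins, a query function Q choosing the list of
  query points from the coins and the samples (but not from any values of f), and a
  decision function A seeing coins, samples and the answers f(q) for q in the query list.
  Acceptance probability on input f under distribution D:\<close>
definition accept_prob ::
  "nat \<Rightarrow> nat pmf \<Rightarrow> (nat \<Rightarrow> nat list list \<Rightarrow> nat list list)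
     \<Rightarrow> (nat \<Rightarrow> nat list list \<Rightarrow> real list \<Rightarrow> bool)
     \<Rightarrow> nat list pmf \<Rightarrow> (nat list \<Rightarrow> real) \<Rightarrow> real" where
  "accept_prob m R Q A D f =
     measure_pmf.prob (pair_pmf R (iid_pmf m D)) {(c, s). A c s (map f (Q c s))}"

end

theory Submission
  imports Defs
begin

text \<open>
  Tester: for each direction \<open>r\<close>, draw \<open>\<lceil>8/\<epsilon>\<rceil>\<close> samples \<open>x\<close> and query \<open>f\<close> at \<open>x\<close> and at the points
  of the line through \<open>x\<close> in direction \<open>r\<close> whose coordinates lie on the search path of \<open>x\<^sub>r\<close> in a
  balanced binary search tree; accept iff some function with the property agrees with all answers.
  Two coordinates on a line share a search-path node between them, so the points of a line that pass
  their own test are pairwise consistent, and \<open>f\<close> restricted to them extends to a function \<open>F\<^sub>r\<close>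
  satisfying the bounds in direction \<open>r\<close>.

  What remains is the dimension reduction: \<open>f\<close> agrees with a function in the property off a set of
  measure \<open>4 \<Sum>\<^sub>r \<P>[f \<noteq> F\<^sub>r]\<close>. Let \<open>V(f, s)\<close> be the distance from \<open>f\<close> to the property in the \<open>L\<^sup>1\<close>-like
  loss that does not charge for decreasing \<open>f\<close> by at most \<open>s\<close>. For small \<open>s\<close>, the drop
  \<open>V(f, 0) - V(f, s)\<close> is at least \<open>s/2\<close> times the measure of the set where \<open>f\<close> differs from an
  \<open>L\<^sup>1\<close>-projection of \<open>f\<close>. By an exchange argument the drop changes by at most
  \<open>s \<P>[f \<noteq> f']\<close> when \<open>f\<close> is replaced by \<open>f'\<close>. If \<open>f'\<close> satisfies the bounds in the first direction, then
  so do suitable \<open>L\<^sup>1\<close>-projections of its slices, because projections are monotone; hence the drop of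
  \<open>f'\<close> is at most the average of the drops of the slices. Passing from \<open>f\<close> to \<open>F\<^sub>1\<close> and, after
  slicing, back to \<open>f\<close> costs \<open>2 s \<P>[f \<noteq> F\<^sub>1]\<close>; induction on the dimension gives the bound.
\<close>

subsection \<open>The grid and the property\<close>

text \<open>The bounds of a single direction: the repairs of \<open>f\<close> along lines satisfy
  these, but need not lie in \<open>prop_B\<close>.\<close>

definition dim_B :: "nat \<Rightarrow> nat \<Rightarrow> (nat \<Rightarrow> nat \<Rightarrow> real) \<Rightarrow> (nat \<Rightarrow> nat \<Rightarrow> real) \<Rightarrow> nat
    \<Rightarrow> (nat list \<Rightarrow> real) set" where
  "dim_B n d l u r = {f. \<forall>x\<in>grid n d. x ! r < n \<longrightarrow>
      l r (x ! r) \<le> f (step x r) - f x \<and> f (step x r) - f x \<le> u r (x ! r)}"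

lemma prop_B_iff_dim_B: "f \<in> prop_B n d l u \<longleftrightarrow> (\<forall>r<d. f \<in> dim_B n d l u r)"
  by (auto simp: prop_B_def dim_B_def)

lemma grid_0: "grid n 0 = {[]}"
  by (auto simp: grid_def)

lemma grid_Suc: "grid n (Suc d) = (\<lambda>(a, p). a # p) ` ({1..n} \<times> grid n d)"
proof (intro set_eqI iffI)
  fix x assume "x \<in> grid n (Suc d)"
  then have x: "length x = Suc d" "\<forall>i<Suc d. 1 \<le> x ! i \<and> x ! i \<le> n"
    by (auto simp: grid_def)
  obtain a p where ap: "x = a # p" using x(1) by (cases x) auto
  have "1 \<le> a \<and> a \<le> n" using x(2)[rule_format, of 0] ap by simp
  moreover have "p \<in> grid n d"
    using x ap x(2)[rule_format, of "Suc i" for i] by (auto simp: grid_def)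
  ultimately show "x \<in> (\<lambda>(a, p). a # p) ` ({1..n} \<times> grid n d)" using ap by force
next
  fix x assume "x \<in> (\<lambda>(a, p). a # p) ` ({1..n} \<times> grid n d)"
  then show "x \<in> grid n (Suc d)" by (auto simp: grid_def nth_Cons split: nat.split)
qed

lemma finite_grid: "finite (grid n d)"
  by (induction d) (auto simp: grid_0 grid_Suc)

lemma sum_grid_Suc: "(\<Sum>x\<in>grid n (Suc d). F x) = (\<Sum>a=1..n. \<Sum>p\<in>grid n d. F (a # p))"
proof -
  have "inj_on (\<lambda>(a, p). a # p) ({1..n} \<times> grid n d)" by (auto simp: inj_on_def)
  then have "(\<Sum>x\<in>grid n (Suc d). F x) = (\<Sum>(a, p)\<in>{1..n} \<times> grid n d. F (a # p))"
    by (simp add: grid_Suc sum.reindex o_def case_prod_unfold)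
  then show ?thesis by (simp add: sum.cartesian_product)
qed

lemma step_in_grid: "x \<in> grid n d \<Longrightarrow> r < d \<Longrightarrow> x ! r < n \<Longrightarrow> step x r \<in> grid n d"
  by (auto simp: grid_def step_def nth_list_update)

lemma ball_grid_Suc: "(\<forall>x\<in>grid n (Suc d). Q x) \<longleftrightarrow> (\<forall>a\<in>{1..n}. \<forall>p\<in>grid n d. Q (a # p))"
  by (auto simp: grid_Suc)

lemma dim_B_Suc_0:
  "f \<in> dim_B n (Suc d) l u 0 \<longleftrightarrow> (\<forall>a\<in>{1..<n}. \<forall>p\<in>grid n d.
     l 0 a \<le> f (Suc a # p) - f (a # p) \<and> f (Suc a # p) - f (a # p) \<le> u 0 a)"
  unfolding dim_B_def mem_Collect_eq ball_grid_Suc by (auto simp: step_def)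

lemma dim_B_Suc_Suc:
  "f \<in> dim_B n (Suc d) l u (Suc r) \<longleftrightarrow>
     (\<forall>a\<in>{1..n}. (\<lambda>p. f (a # p)) \<in> dim_B n d (\<lambda>r. l (Suc r)) (\<lambda>r. u (Suc r)) r)"
  unfolding dim_B_def mem_Collect_eq ball_grid_Suc by (auto simp: step_def)

lemma prop_B_Suc:
  "f \<in> prop_B n (Suc d) l u \<longleftrightarrow> f \<in> dim_B n (Suc d) l u 0 \<and>
     (\<forall>a\<in>{1..n}. (\<lambda>p. f (a # p)) \<in> prop_B n d (\<lambda>r. l (Suc r)) (\<lambda>r. u (Suc r)))"
  unfolding prop_B_iff_dim_B All_less_Suc2 dim_B_Suc_Suc by blast

lemma prop_B_add_const: "f \<in> prop_B n d l u \<Longrightarrow> (\<lambda>x. f x + c) \<in> prop_B n d l u"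
  by (simp add: prop_B_def)

text \<open>Each constraint has the form \<open>f y \<le> f x + c\<close> with \<open>c\<close>
  independent of \<open>f\<close>; such inequalities survive min, max and averaging. All exchange
  arguments rest on this closure.\<close>

lemma
  assumes "f \<in> prop_B n d l u" "g \<in> prop_B n d l u"
  shows prop_B_min: "(\<lambda>x. min (f x) (g x)) \<in> prop_B n d l u"
    and prop_B_max: "(\<lambda>x. max (f x) (g x)) \<in> prop_B n d l u"
    and prop_B_midpoint: "(\<lambda>x. (f x + g x) / 2) \<in> prop_B n d l u"
proof -
  have *: "l r (x ! r) \<le> f (step x r) - f x \<and> f (step x r) - f x \<le> u r (x ! r) \<and>
      l r (x ! r) \<le> g (step x r) - g x \<and> g (step x r) - g x \<le> u r (x ! r)"
    if "x \<in> grid n d" "r < d" "x ! r < n" for x r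
    using assms that by (auto simp: prop_B_def)
  show "(\<lambda>x. min (f x) (g x)) \<in> prop_B n d l u"
    unfolding prop_B_def using * by (fastforce simp: min_def)
  show "(\<lambda>x. max (f x) (g x)) \<in> prop_B n d l u"
    unfolding prop_B_def using * by (fastforce simp: max_def)
  show "(\<lambda>x. (f x + g x) / 2) \<in> prop_B n d l u"
    unfolding prop_B_def using * by (fastforce simp: field_simps)
qed

lemma prop_B_cong:
  assumes "f \<in> prop_B n d l u" "\<And>x. x \<in> grid n d \<Longrightarrow> f x = g x"
  shows "g \<in> prop_B n d l u"
  using assms step_in_grid by (fastforce simp: prop_B_def)

lemma prop_B_nonempty:
  assumes "bounding_family n d l u"
  shows "prop_B n d l u \<noteq> {}"
proof -
  \<comment> \<open>Separable potential that climbs at the upper bounds; the summand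
    \<open>t = 0\<close> is the same at every grid point.\<close>
  define g where "g x = (\<Sum>r<d. \<Sum>t<x ! r. u r t)" for x :: "nat list"
  have "g (step x r) - g x = u r (x ! r)" if "x \<in> grid n d" "r < d" for x r
  proof -
    have len: "length x = d" using that by (simp add: grid_def)
    have "g (step x r) - g x = (\<Sum>i<d. (\<Sum>t<step x r ! i. u i t) - (\<Sum>t<x ! i. u i t))"
      by (simp add: g_def sum_subtractf)
    also have "\<dots> = (\<Sum>i<d. if i = r then u r (x ! r) else 0)"
      by (rule sum.cong) (auto simp: step_def nth_list_update len)
    finally show ?thesis using that by simp
  qed
  moreover have "l r (x ! r) \<le> u r (x ! r)" if "x \<in> grid n d" "r < d" "x ! r < n" for x r
  proof -
    have "x ! r \<in> {1..n - 1}" using that by (auto simp: grid_def)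
    then show ?thesis using assms that unfolding bounding_family_def by (meson less_imp_le)
  qed
  ultimately have "g \<in> prop_B n d l u" by (auto simp: prop_B_def)
  then show ?thesis by blast
qed

subsection \<open>A lopsided distance to the property\<close>

text \<open>For \<open>s \<ge> 0\<close> this is the distance of \<open>z\<close> from the interval
  \<open>[-s, 0]\<close>, that is, the least \<open>|z + t|\<close> over \<open>t\<close> in
  \<open>[0, s]\<close>.\<close>

definition loss :: "real \<Rightarrow> real \<Rightarrow> real" where
  "loss s z = max z 0 + max (- z - s) 0"

definition skew_dist :: "nat \<Rightarrow> nat \<Rightarrow> (nat \<Rightarrow> nat \<Rightarrow> real) \<Rightarrow> (nat \<Rightarrow> nat \<Rightarrow> real)
    \<Rightarrow> (nat list \<Rightarrow> real) \<Rightarrow> (nat list \<Rightarrow> real) \<Rightarrow> real \<Rightarrow> real" where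
  "skew_dist n d l u W f s =
     (INF h\<in>prop_B n d l u. \<Sum>x\<in>grid n d. W x * loss s (h x - f x))"

lemma loss_nonneg: "0 \<le> loss s z"
  by (simp add: loss_def)

lemma loss_0: "loss 0 z = \<bar>z\<bar>"
  by (simp add: loss_def)

lemma skew_dist_le:
  assumes "\<And>x. x \<in> grid n d \<Longrightarrow> 0 \<le> W x" "h \<in> prop_B n d l u"
  shows "skew_dist n d l u W f s \<le> (\<Sum>x\<in>grid n d. W x * loss s (h x - f x))"
  unfolding skew_dist_def
proof (rule cINF_lower)
  show "bdd_below ((\<lambda>h. \<Sum>x\<in>grid n d. W x * loss s (h x - f x)) ` prop_B n d l u)"
    by (rule bdd_belowI2[of _ 0]) (auto intro!: sum_nonneg mult_nonneg_nonneg assms loss_nonneg)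
qed fact

lemma skew_dist_ge:
  assumes "bounding_family n d l u"
    and "\<And>h. h \<in> prop_B n d l u \<Longrightarrow> c \<le> (\<Sum>x\<in>grid n d. W x * loss s (h x - f x))"
  shows "c \<le> skew_dist n d l u W f s"
  unfolding skew_dist_def by (rule cINF_greatest) (use assms prop_B_nonempty in auto)

text \<open>The two arguments are \<open>b\<close> clamped to \<open>[a, a + s]\<close> and \<open>a\<close> clamped to \<open>[b - s, b]\<close>.\<close>

lemma loss_exchange:
  assumes "0 \<le> s"
  shows "loss 0 (max a (min b (a + s)) - c) + loss s (min b (max a (b - s)) - c)
     \<le> loss s (a - c) + loss 0 (b - c)"
  using assms unfolding loss_def by (smt (verit))

text \<open>The first clamped value lies in \<open>[a, a + s]\<close>, so it is within
  \<open>s\<close> of the best \<open>a + t\<close> with \<open>t\<close> in \<open>[0, s]\<close>.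
  The second lies in \<open>[b - s, b]\<close>, so some such \<open>t\<close> raises it to
  \<open>b\<close>.\<close>

lemma loss_exchange':
  assumes "0 \<le> s"
  shows "loss 0 (max a (min b (a + s)) - c) + loss s (min b (max a (b - s)) - c')
     \<le> loss s (a - c) + loss 0 (b - c') + s"
  using assms unfolding loss_def by (smt (verit))

text \<open>Candidates \<open>h1\<close> for \<open>V(f, s)\<close> and \<open>h2\<close> for
  \<open>V(f', 0)\<close> are recombined into candidates for \<open>V(f, 0)\<close> and
  \<open>V(f', s)\<close>; clamping uses only shifts, min and max, so the property is kept. Only
  points with \<open>f x \<noteq> f' x\<close> can raise the total, each by at most \<open>s\<close>
  times its weight.\<close>

lemma skew_dist_perturb:
  assumes "bounding_family n d l u" "\<And>x. x \<in> grid n d \<Longrightarrow> 0 \<le> W x" "0 \<le> s"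
  shows "skew_dist n d l u W f 0 + skew_dist n d l u W f' s
    \<le> skew_dist n d l u W f s + skew_dist n d l u W f' 0
       + s * (\<Sum>x\<in>grid n d. W x * of_bool (f x \<noteq> f' x))"
    (is "_ \<le> _ + _ + s * ?\<delta>")
proof -
  let ?X = "grid n d" let ?P = "prop_B n d l u"
  have key: "skew_dist n d l u W f 0 + skew_dist n d l u W f' s
    \<le> (\<Sum>x\<in>?X. W x * loss s (h1 x - f x)) + (\<Sum>x\<in>?X. W x * loss 0 (h2 x - f' x)) + s * ?\<delta>"
    if h: "h1 \<in> ?P" "h2 \<in> ?P" for h1 h2
  proof -
    define g1 where "g1 x = max (h1 x) (min (h2 x) (h1 x + s))" for x
    define g2 where "g2 x = min (h2 x) (max (h1 x) (h2 x + - s))" for x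
    have "g1 \<in> ?P" "g2 \<in> ?P"
      unfolding g1_def g2_def by (intro prop_B_min prop_B_max prop_B_add_const h)+
    then have "skew_dist n d l u W f 0 + skew_dist n d l u W f' s
      \<le> (\<Sum>x\<in>?X. W x * loss 0 (g1 x - f x)) + (\<Sum>x\<in>?X. W x * loss s (g2 x - f' x))"
      using assms(2) by (intro add_mono skew_dist_le)
    also have "\<dots> = (\<Sum>x\<in>?X. W x * (loss 0 (g1 x - f x) + loss s (g2 x - f' x)))"
      by (simp add: sum.distrib distrib_left)
    also have "\<dots> \<le> (\<Sum>x\<in>?X. W x * (loss s (h1 x - f x) + loss 0 (h2 x - f' x)
        + s * of_bool (f x \<noteq> f' x)))"
      using loss_exchange[OF assms(3)] loss_exchange'[OF assms(3)] assms(2)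
      by (intro sum_mono mult_left_mono) (auto simp: g1_def g2_def)
    also have "\<dots> = (\<Sum>x\<in>?X. W x * loss s (h1 x - f x)) + (\<Sum>x\<in>?X. W x * loss 0 (h2 x - f' x)) + s * ?\<delta>"
      by (simp add: sum.distrib distrib_left sum_distrib_left mult_ac)
    finally show ?thesis .
  qed
  have "skew_dist n d l u W f 0 + skew_dist n d l u W f' s - skew_dist n d l u W f s - s * ?\<delta>
      \<le> skew_dist n d l u W f' 0"
  proof (rule skew_dist_ge[OF assms(1)])
    fix h2 assume h2: "h2 \<in> ?P"
    have "skew_dist n d l u W f 0 + skew_dist n d l u W f' s
        - (\<Sum>x\<in>?X. W x * loss 0 (h2 x - f' x)) - s * ?\<delta> \<le> skew_dist n d l u W f s"
      using key[OF _ h2] by (intro skew_dist_ge[OF assms(1)]) (smt (verit))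
    then show "skew_dist n d l u W f 0 + skew_dist n d l u W f' s - skew_dist n d l u W f s - s * ?\<delta>
        \<le> (\<Sum>x\<in>?X. W x * loss 0 (h2 x - f' x))" by linarith
  qed
  then show ?thesis by linarith
qed

subsection \<open>Minimizers and their monotonicity\<close>

text \<open>Tychonoff's theorem for the pointwise topology on functions, in which minimizers are
  sought.\<close>

lemma compact_PiE_UNIV:
  fixes K :: "'a \<Rightarrow> 'b::topological_space set"
  assumes "\<And>i. compact (K i)"
  shows "compact (PiE UNIV K)"
proof -
  have "compactin (product_topology (\<lambda>i. euclidean) UNIV) (PiE UNIV K)"
    using assms by (auto simp: compactin_PiE)
  then show ?thesis by (simp add: euclidean_product_topology)
qed

lemma closed_prop_B: "closed (prop_B n d l u)"
proof -
  have "prop_B n d l u = (\<Inter>x\<in>grid n d. \<Inter>r\<in>{r. r < d \<and> x ! r < n}.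
      {f. l r (x ! r) \<le> f (step x r) - f x} \<inter> {f. f (step x r) - f x \<le> u r (x ! r)})"
    by (auto simp: prop_B_def)
  also have "closed \<dots>"
    by (intro closed_INT ballI closed_Int closed_Collect_le continuous_on_diff continuous_on_const
        continuous_on_product_coordinates)
  finally show ?thesis .
qed

text \<open>The term weighted by \<open>\<eta>\<close> is needed because minimizers for \<open>\<eta> = 0\<close> are not unique and therefore
  not monotone in \<open>f\<close>.\<close>

lemma exists_minimizer:
  assumes "bounding_family n d l u" "\<And>x. x \<in> grid n d \<Longrightarrow> 0 \<le> W x" "0 \<le> \<eta>"
  shows "\<exists>h\<in>prop_B n d l u. \<forall>g\<in>prop_B n d l u.
      (\<Sum>x\<in>grid n d. W x * \<bar>h x - f x\<bar> + \<eta> * (h x - f x)\<^sup>2)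
      \<le> (\<Sum>x\<in>grid n d. W x * \<bar>g x - f x\<bar> + \<eta> * (g x - f x)\<^sup>2)"
proof -
  let ?X = "grid n d" let ?P = "prop_B n d l u"
  define J where "J h = (\<Sum>x\<in>?X. W x * \<bar>h x - f x\<bar> + \<eta> * (h x - f x)\<^sup>2)" for h
  obtain g0 where g0: "g0 \<in> ?P" using prop_B_nonempty[OF assms(1)] by blast
  define A where "A = (\<Sum>x\<in>?X. \<bar>f x - g0 x\<bar>)"
  have A: "\<bar>f x - g0 x\<bar> \<le> A" if "x \<in> ?X" for x
    unfolding A_def using that finite_grid by (intro member_le_sum) auto
  \<comment> \<open>The tube of radius \<open>A\<close> around \<open>g0\<close> contains
    \<open>f\<close>, so clamping into it brings values closer to \<open>f\<close>, and a compact
    set of candidates suffices. Off the grid nothing is constrained, and values are pinned to 0 to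
    keep the product compact.\<close>
  define K where "K x = (if x \<in> ?X then {g0 x - A..g0 x + A} else {0})" for x
  define clamp where "clamp g x = (if x \<in> ?X then max (g0 x + - A) (min (g0 x + A) (g x)) else 0)"
    for g :: "nat list \<Rightarrow> real" and x
  have clamp: "clamp g \<in> PiE UNIV K \<inter> ?P" "J (clamp g) \<le> J g" if g: "g \<in> ?P" for g
  proof -
    have "(\<lambda>x. max (g0 x + - A) (min (g0 x + A) (g x))) \<in> ?P"
      by (intro prop_B_max prop_B_min prop_B_add_const g0 g)
    then have "clamp g \<in> ?P" by (rule prop_B_cong) (simp add: clamp_def)
    moreover have "clamp g x \<in> K x" for x
      using A[of x] by (auto simp: clamp_def K_def)
    ultimately show "clamp g \<in> PiE UNIV K \<inter> ?P" by auto
    have closer: "\<bar>clamp g x - f x\<bar> \<le> \<bar>g x - f x\<bar>" if "x \<in> ?X" for x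
      using A[OF that] that by (auto simp: clamp_def)
    then have "(clamp g x - f x)\<^sup>2 \<le> (g x - f x)\<^sup>2" if "x \<in> ?X" for x
      using that by (simp add: abs_le_square_iff)
    with closer show "J (clamp g) \<le> J g"
      unfolding J_def using assms(2,3) by (intro sum_mono add_mono mult_left_mono) auto
  qed
  have "compact (PiE UNIV K \<inter> ?P)"
    by (intro compact_Int_closed compact_PiE_UNIV closed_prop_B) (simp add: K_def)
  moreover have "PiE UNIV K \<inter> ?P \<noteq> {}" using clamp(1)[OF g0] by (rule ex_in_conv[THEN iffD1, OF exI])
  moreover have "continuous_on (PiE UNIV K \<inter> ?P) J"
    unfolding J_def
    by (intro continuous_on_sum continuous_on_add continuous_on_mult continuous_on_rabs
        continuous_on_power continuous_on_diff continuous_on_const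
        continuous_on_subset[OF continuous_on_product_coordinates subset_UNIV])
  ultimately have "\<exists>h\<in>PiE UNIV K \<inter> ?P. \<forall>g\<in>PiE UNIV K \<inter> ?P. J h \<le> J g"
    by (rule continuous_attains_inf)
  then obtain h where h: "h \<in> PiE UNIV K \<inter> ?P" "\<And>g. g \<in> PiE UNIV K \<inter> ?P \<Longrightarrow> J h \<le> J g"
    by (elim bexE) simp
  show ?thesis
  proof (intro bexI[of _ h] ballI)
    show "h \<in> ?P" using h by blast
    fix g assume g: "g \<in> ?P"
    have "J h \<le> J g" using h(2)[OF clamp(1)[OF g]] clamp(2)[OF g] by (rule order_trans)
    then show "(\<Sum>x\<in>?X. W x * \<bar>h x - f x\<bar> + \<eta> * (h x - f x)\<^sup>2)
      \<le> (\<Sum>x\<in>?X. W x * \<bar>g x - f x\<bar> + \<eta> * (g x - f x)\<^sup>2)" by (simp add: J_def)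
  qed
qed

text \<open>Quantitative strict convexity: when the larger value \<open>a\<close> aims at the
  smaller target \<open>c\<close>, moving both values to their midpoint saves at least
  \<open>(a - b)\<^sup>2 / 2\<close>.\<close>

lemma square_dist_midpoint:
  fixes a b c e :: real
  assumes "c \<le> e" "b \<le> a"
  shows "((a + b) / 2 - c)\<^sup>2 + ((b + a) / 2 - e)\<^sup>2 + (a - b)\<^sup>2 / 2 \<le> (a - c)\<^sup>2 + (b - e)\<^sup>2"
proof -
  have "(a - c)\<^sup>2 + (b - e)\<^sup>2 - (((a + b) / 2 - c)\<^sup>2 + ((b + a) / 2 - e)\<^sup>2 + (a - b)\<^sup>2 / 2)
    = (a - b) * (e - c)"
    by (simp add: power2_eq_square field_simps)
  moreover have "0 \<le> (a - b) * (e - c)" using assms by simp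
  ultimately show ?thesis by linarith
qed

text \<open>Projections are monotone and commute with adding constants. If \<open>h1\<close>
  exceeded \<open>h2 + c\<close> somewhere, moving the two towards each other there would lower the
  total cost strictly, thanks to the squares.\<close>

lemma minimizer_comparison:
  fixes W :: "nat list \<Rightarrow> real" and n d :: nat and \<eta> :: real
  defines "J f h \<equiv> \<Sum>x\<in>grid n d. W x * \<bar>h x - f x\<bar> + \<eta> * (h x - f x)\<^sup>2"
  assumes W: "\<And>x. x \<in> grid n d \<Longrightarrow> 0 \<le> W x" and \<eta>: "0 < \<eta>"
    and h1: "h1 \<in> prop_B n d l u" "\<And>g. g \<in> prop_B n d l u \<Longrightarrow> J f1 h1 \<le> J f1 g"
    and h2: "h2 \<in> prop_B n d l u" "\<And>g. g \<in> prop_B n d l u \<Longrightarrow> J f2 h2 \<le> J f2 g"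
    and f: "\<And>x. x \<in> grid n d \<Longrightarrow> f1 x \<le> f2 x + c"
    and y: "y \<in> grid n d"
  shows "h1 y \<le> h2 y + c"
proof (rule ccontr)
  assume contra: "\<not> h1 y \<le> h2 y + c"
  let ?X = "grid n d" let ?P = "prop_B n d l u"
  define k where "k x = h2 x + c" for x
  \<comment> \<open>Nothing changes where \<open>h1 \<le> k\<close>; elsewhere both functions take
    the midpoint. Merely swapping the values would save nothing at points where
    \<open>f1 = f2 + c\<close>.\<close>
  define g1 where "g1 x = (h1 x + min (h1 x) (k x)) / 2" for x
  define g2 where "g2 x = (k x + max (h1 x) (k x)) / 2" for x
  have k: "k \<in> ?P" unfolding k_def by (intro prop_B_add_const h2(1))
  have "g1 \<in> ?P" "(\<lambda>x. g2 x + - c) \<in> ?P"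
    unfolding g1_def g2_def by (intro prop_B_add_const prop_B_midpoint prop_B_min prop_B_max h1(1) k)+
  then have "J f1 h1 + J f2 h2 \<le> J f1 g1 + J f2 (\<lambda>x. g2 x + - c)"
    by (intro add_mono h1(2) h2(2))
  also have "\<dots> = (\<Sum>x\<in>?X. W x * (\<bar>g1 x - f1 x\<bar> + \<bar>g2 x - (f2 x + c)\<bar>)
      + \<eta> * ((g1 x - f1 x)\<^sup>2 + (g2 x - (f2 x + c))\<^sup>2))"
    unfolding J_def sum.distrib[symmetric] by (rule sum.cong) (auto simp: algebra_simps)
  also have "\<dots> < (\<Sum>x\<in>?X. W x * (\<bar>h1 x - f1 x\<bar> + \<bar>k x - (f2 x + c)\<bar>)
      + \<eta> * ((h1 x - f1 x)\<^sup>2 + (k x - (f2 x + c))\<^sup>2))"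
  proof (rule sum_strict_mono_ex1[OF finite_grid])
    have abs: "\<bar>g1 x - f1 x\<bar> + \<bar>g2 x - (f2 x + c)\<bar> \<le> \<bar>h1 x - f1 x\<bar> + \<bar>k x - (f2 x + c)\<bar>"
      if "x \<in> ?X" for x
      using f[OF that] unfolding g1_def g2_def by (simp add: min_def max_def abs_if field_simps)
    have sq: "(g1 x - f1 x)\<^sup>2 + (g2 x - (f2 x + c))\<^sup>2 + (max 0 (h1 x - k x))\<^sup>2 / 2
      \<le> (h1 x - f1 x)\<^sup>2 + (k x - (f2 x + c))\<^sup>2" if "x \<in> ?X" for x
      using square_dist_midpoint[OF f[OF that], of "k x" "h1 x"]
      by (cases "h1 x \<le> k x") (auto simp: g1_def g2_def)
    show "\<forall>x\<in>?X. W x * (\<bar>g1 x - f1 x\<bar> + \<bar>g2 x - (f2 x + c)\<bar>)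
      + \<eta> * ((g1 x - f1 x)\<^sup>2 + (g2 x - (f2 x + c))\<^sup>2)
      \<le> W x * (\<bar>h1 x - f1 x\<bar> + \<bar>k x - (f2 x + c)\<bar>)
      + \<eta> * ((h1 x - f1 x)\<^sup>2 + (k x - (f2 x + c))\<^sup>2)"
    proof
      fix x assume x: "x \<in> ?X"
      have "(g1 x - f1 x)\<^sup>2 + (g2 x - (f2 x + c))\<^sup>2 \<le> (h1 x - f1 x)\<^sup>2 + (k x - (f2 x + c))\<^sup>2"
        using sq[OF x] zero_le_power2[of "max 0 (h1 x - k x)"] by linarith
      then show "W x * (\<bar>g1 x - f1 x\<bar> + \<bar>g2 x - (f2 x + c)\<bar>)
        + \<eta> * ((g1 x - f1 x)\<^sup>2 + (g2 x - (f2 x + c))\<^sup>2)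
        \<le> W x * (\<bar>h1 x - f1 x\<bar> + \<bar>k x - (f2 x + c)\<bar>)
        + \<eta> * ((h1 x - f1 x)\<^sup>2 + (k x - (f2 x + c))\<^sup>2)"
        by (rule add_mono[OF mult_left_mono[OF abs[OF x] W[OF x]] mult_left_mono[OF _ less_imp_le[OF \<eta>]]])
    qed
    show "\<exists>x\<in>?X. W x * (\<bar>g1 x - f1 x\<bar> + \<bar>g2 x - (f2 x + c)\<bar>)
      + \<eta> * ((g1 x - f1 x)\<^sup>2 + (g2 x - (f2 x + c))\<^sup>2)
      < W x * (\<bar>h1 x - f1 x\<bar> + \<bar>k x - (f2 x + c)\<bar>)
      + \<eta> * ((h1 x - f1 x)\<^sup>2 + (k x - (f2 x + c))\<^sup>2)"
    proof (rule bexI[OF _ y])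
      have "0 < (max 0 (h1 y - k y))\<^sup>2" using contra by (simp add: k_def)
      then have "(g1 y - f1 y)\<^sup>2 + (g2 y - (f2 y + c))\<^sup>2 < (h1 y - f1 y)\<^sup>2 + (k y - (f2 y + c))\<^sup>2"
        using sq[OF y] by linarith
      then show "W y * (\<bar>g1 y - f1 y\<bar> + \<bar>g2 y - (f2 y + c)\<bar>)
        + \<eta> * ((g1 y - f1 y)\<^sup>2 + (g2 y - (f2 y + c))\<^sup>2)
        < W y * (\<bar>h1 y - f1 y\<bar> + \<bar>k y - (f2 y + c)\<bar>)
        + \<eta> * ((h1 y - f1 y)\<^sup>2 + (k y - (f2 y + c))\<^sup>2)"
        by (rule add_le_less_mono[OF mult_left_mono[OF abs[OF y] W[OF y]] mult_strict_left_mono[OF _ \<eta>]])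
    qed
  qed
  also have "\<dots> = J f1 h1 + J f2 h2"
    unfolding J_def sum.distrib[symmetric] k_def by (rule sum.cong) (auto simp: algebra_simps)
  finally show False by simp
qed

subsection \<open>Dimension reduction\<close>

lemma bounding_family_Suc:
  "bounding_family n (Suc d) l u \<Longrightarrow> bounding_family n d (\<lambda>r. l (Suc r)) (\<lambda>r. u (Suc r))"
  by (auto simp: bounding_family_def)

lemma skew_dist_0_attained:
  assumes "bounding_family n d l u" "\<And>x. x \<in> grid n d \<Longrightarrow> 0 \<le> W x"
  shows "\<exists>h\<in>prop_B n d l u. skew_dist n d l u W f 0 = (\<Sum>x\<in>grid n d. W x * \<bar>h x - f x\<bar>)"
proof -
  obtain h where h: "h \<in> prop_B n d l u"
    "\<And>g. g \<in> prop_B n d l u \<Longrightarrow>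
      (\<Sum>x\<in>grid n d. W x * \<bar>h x - f x\<bar>) \<le> (\<Sum>x\<in>grid n d. W x * \<bar>g x - f x\<bar>)"
    using exists_minimizer[where W = W and f = f, OF assms order_refl] by auto
  show ?thesis
  proof (intro bexI[of _ h] h(1) antisym)
    show "skew_dist n d l u W f 0 \<le> (\<Sum>x\<in>grid n d. W x * \<bar>h x - f x\<bar>)"
      using skew_dist_le[OF assms(2) h(1), where s = 0] by (simp add: loss_0)
    show "(\<Sum>x\<in>grid n d. W x * \<bar>h x - f x\<bar>) \<le> skew_dist n d l u W f 0"
      using skew_dist_ge[OF assms(1)] h(2) by (simp add: loss_0)
  qed
qed

text \<open>Project each slice separately. Neighbouring slices of \<open>f\<close> differ by amounts
  between \<open>l 0 a\<close> and \<open>u 0 a\<close>; by comparison so do their regularized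
  projections, hence these glue to a function with the property.\<close>

lemma skew_dist_Suc_le:
  assumes bf: "bounding_family n (Suc d) l u"
    and W: "\<And>a p. W (a # p) = w a * W' p" "\<And>a. 0 \<le> w a" "\<And>p. 0 \<le> W' p"
    and f: "f \<in> dim_B n (Suc d) l u 0"
  shows "skew_dist n (Suc d) l u W f 0
    \<le> (\<Sum>a=1..n. w a * skew_dist n d (\<lambda>r. l (Suc r)) (\<lambda>r. u (Suc r)) W' (\<lambda>p. f (a # p)) 0)"
proof -
  let ?P = "prop_B n d (\<lambda>r. l (Suc r)) (\<lambda>r. u (Suc r))"
  let ?V = "\<lambda>a. skew_dist n d (\<lambda>r. l (Suc r)) (\<lambda>r. u (Suc r)) W' (\<lambda>p. f (a # p)) 0"
  note bf' = bounding_family_Suc[OF bf]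
  define J where "J \<eta> f h = (\<Sum>p\<in>grid n d. W' p * \<bar>h p - f p\<bar> + \<eta> * (h p - f p)\<^sup>2)"
    for \<eta> :: real and f h :: "nat list \<Rightarrow> real"
  define Q where "Q f h = (\<Sum>p\<in>grid n d. (h p - f p)\<^sup>2)" for f h :: "nat list \<Rightarrow> real"
  have J_eq: "J \<eta> f h = (\<Sum>p\<in>grid n d. W' p * \<bar>h p - f p\<bar>) + \<eta> * Q f h" for \<eta> f h
    by (simp add: J_def Q_def sum.distrib sum_distrib_left)
  have "\<forall>a. \<exists>h. h \<in> ?P \<and> ?V a = (\<Sum>p\<in>grid n d. W' p * \<bar>h p - f (a # p)\<bar>)"
    using skew_dist_0_attained[where W = W', OF bf' W(3)] by blast
  from choice[OF this] obtain h0 where h0: "\<And>a. h0 a \<in> ?P"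
    "\<And>a. ?V a = (\<Sum>p\<in>grid n d. W' p * \<bar>h0 a p - f (a # p)\<bar>)" by blast
  \<comment> \<open>The price of regularization, measured at the exact projections
    \<open>h0\<close>; it does not depend on \<open>\<eta>\<close>, so \<open>\<eta> * C\<close>
    tends to 0.\<close>
  define C where "C = (\<Sum>a=1..n. w a * Q (\<lambda>p. f (a # p)) (h0 a))"
  have C: "0 \<le> C" unfolding C_def Q_def by (intro sum_nonneg mult_nonneg_nonneg W) auto
  have approx: "skew_dist n (Suc d) l u W f 0 \<le> (\<Sum>a=1..n. w a * ?V a) + \<eta> * C" if \<eta>: "0 < \<eta>" for \<eta>
  proof -
    have "\<exists>h. h \<in> ?P \<and> (\<forall>g\<in>?P. J \<eta> (\<lambda>p. f (a # p)) h \<le> J \<eta> (\<lambda>p. f (a # p)) g)" for a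
      using exists_minimizer[where W = W' and f = "\<lambda>p. f (a # p)", OF bf' W(3) less_imp_le[OF \<eta>]]
      unfolding J_def by blast
    then have "\<forall>a. \<exists>h. h \<in> ?P \<and> (\<forall>g\<in>?P. J \<eta> (\<lambda>p. f (a # p)) h \<le> J \<eta> (\<lambda>p. f (a # p)) g)"
      by (rule allI)
    from choice[OF this] obtain h where h: "\<And>a. h a \<in> ?P"
      "\<And>a g. g \<in> ?P \<Longrightarrow> J \<eta> (\<lambda>p. f (a # p)) (h a) \<le> J \<eta> (\<lambda>p. f (a # p)) g" by blast
    define k where "k x = h (hd x) (tl x)" for x
    have k: "k \<in> prop_B n (Suc d) l u"
      unfolding prop_B_Suc dim_B_Suc_0
    proof (intro conjI ballI)
      fix a p assume a: "a \<in> {1..<n}" and p: "p \<in> grid n d"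
      have fa: "l 0 a \<le> f (Suc a # q) - f (a # q) \<and> f (Suc a # q) - f (a # q) \<le> u 0 a"
        if "q \<in> grid n d" for q
        using f a that by (auto simp: dim_B_Suc_0)
      \<comment> \<open>Comparison with shift \<open>u 0 a\<close>, then in the opposite direction
        with shift \<open>- l 0 a\<close>.\<close>
      have "h (Suc a) p \<le> h a p + u 0 a"
        using fa by (intro minimizer_comparison[OF W(3) \<eta> h(1) h(2)[unfolded J_def] h(1) h(2)[unfolded J_def] _ p])
          (force simp: field_simps)+
      moreover have "h a p \<le> h (Suc a) p + - l 0 a"
        using fa by (intro minimizer_comparison[OF W(3) \<eta> h(1) h(2)[unfolded J_def] h(1) h(2)[unfolded J_def] _ p])
          (force simp: field_simps)+
      ultimately show "l 0 a \<le> k (Suc a # p) - k (a # p)" "k (Suc a # p) - k (a # p) \<le> u 0 a"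
        by (auto simp: k_def)
    qed (simp add: k_def h(1))
    have "W x \<ge> 0" if "x \<in> grid n (Suc d)" for x
      using that W by (auto simp: grid_Suc)
    then have "skew_dist n (Suc d) l u W f 0 \<le> (\<Sum>x\<in>grid n (Suc d). W x * \<bar>k x - f x\<bar>)"
      using skew_dist_le[OF _ k, where s = 0] by (simp add: loss_0)
    also have "\<dots> = (\<Sum>a=1..n. w a * (\<Sum>p\<in>grid n d. W' p * \<bar>h a p - f (a # p)\<bar>))"
      by (simp add: sum_grid_Suc W(1) k_def sum_distrib_left mult_ac)
    also have "\<dots> \<le> (\<Sum>a=1..n. w a * J \<eta> (\<lambda>p. f (a # p)) (h a))"
      unfolding J_def using \<eta> by (intro sum_mono mult_left_mono W) auto
    also have "\<dots> \<le> (\<Sum>a=1..n. w a * J \<eta> (\<lambda>p. f (a # p)) (h0 a))"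
      by (intro sum_mono mult_left_mono W h h0)
    also have "\<dots> = (\<Sum>a=1..n. w a * ?V a) + \<eta> * C"
      by (simp add: J_eq h0(2) C_def distrib_left sum.distrib sum_distrib_left mult_ac)
    finally show ?thesis .
  qed
  show ?thesis
  proof (rule field_le_epsilon)
    fix e :: real assume e: "0 < e"
    have "skew_dist n (Suc d) l u W f 0 \<le> (\<Sum>a=1..n. w a * ?V a) + e / (C + 1) * C"
      using e C by (intro approx) simp
    also have "e / (C + 1) * C \<le> e" using e C by (simp add: field_simps)
    finally show "skew_dist n (Suc d) l u W f 0 \<le> (\<Sum>a=1..n. w a * ?V a) + e" by simp
  qed
qed

text \<open>Slices of a candidate for \<open>f\<close> are candidates for the slices of
  \<open>f\<close>; this direction needs no bounds on \<open>f\<close>.\<close>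

lemma skew_dist_Suc_ge:
  assumes bf: "bounding_family n (Suc d) l u"
    and W: "\<And>a p. W (a # p) = w a * W' p" "\<And>a. 0 \<le> w a" "\<And>p. 0 \<le> W' p"
  shows "(\<Sum>a=1..n. w a * skew_dist n d (\<lambda>r. l (Suc r)) (\<lambda>r. u (Suc r)) W' (\<lambda>p. f (a # p)) s)
    \<le> skew_dist n (Suc d) l u W f s"
proof (rule skew_dist_ge[OF bf])
  fix h assume h: "h \<in> prop_B n (Suc d) l u"
  have "(\<Sum>a=1..n. w a * skew_dist n d (\<lambda>r. l (Suc r)) (\<lambda>r. u (Suc r)) W' (\<lambda>p. f (a # p)) s)
    \<le> (\<Sum>a=1..n. w a * (\<Sum>p\<in>grid n d. W' p * loss s (h (a # p) - f (a # p))))"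
    using h by (intro sum_mono mult_left_mono skew_dist_le W) (auto simp: prop_B_Suc)
  also have "\<dots> = (\<Sum>x\<in>grid n (Suc d). W x * loss s (h x - f x))"
    by (simp add: sum_grid_Suc W(1) sum_distrib_left mult_ac)
  finally show "(\<Sum>a=1..n. w a * skew_dist n d (\<lambda>r. l (Suc r)) (\<lambda>r. u (Suc r)) W' (\<lambda>p. f (a # p)) s)
    \<le> (\<Sum>x\<in>grid n (Suc d). W x * loss s (h x - f x))" .
qed

lemma prod_list_pmf_Cons:
  "prod_list_pmf (\<mu> # \<mu>s) = map_pmf (\<lambda>(x, xs). x # xs) (pair_pmf \<mu> (prod_list_pmf \<mu>s))"
  by (simp add: pair_pmf_def map_bind_pmf map_pmf_def bind_assoc_pmf bind_return_pmf)

lemma pmf_prod_list_pmf_Cons: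
  "pmf (prod_list_pmf (\<mu> # \<mu>s)) (a # p) = pmf \<mu> a * pmf (prod_list_pmf \<mu>s) p"
proof -
  have "pmf (map_pmf (\<lambda>(x, xs). x # xs) (pair_pmf \<mu> (prod_list_pmf \<mu>s))) ((\<lambda>(x, xs). x # xs) (a, p))
    = pmf (pair_pmf \<mu> (prod_list_pmf \<mu>s)) (a, p)"
    by (rule pmf_map_inj') (auto simp: inj_def)
  then show ?thesis by (simp only: prod_list_pmf_Cons pmf_pair prod.case)
qed

text \<open>Each direction costs \<open>2 * s\<close>: one \<open>s\<close> for replacing
  \<open>f\<close> by \<open>F 0\<close> on the whole grid, one for returning to \<open>f\<close> on
  the slices, where the induction hypothesis is applied to \<open>f\<close> and the slices of
  \<open>F (Suc r)\<close>.\<close>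

lemma skew_dist_drop_le:
  assumes "bounding_family n d l u" "length \<mu>s = d" "0 \<le> s" "\<And>r. r < d \<Longrightarrow> F r \<in> dim_B n d l u r"
  shows "skew_dist n d l u (pmf (prod_list_pmf \<mu>s)) f 0 - skew_dist n d l u (pmf (prod_list_pmf \<mu>s)) f s
    \<le> 2 * s * (\<Sum>r<d. \<Sum>x\<in>grid n d. pmf (prod_list_pmf \<mu>s) x * of_bool (f x \<noteq> F r x))"
  using assms(1,2,4)
proof (induction \<mu>s arbitrary: d l u f F)
  case Nil
  let ?W = "pmf (prod_list_pmf ([] :: nat pmf list))"
  have "f \<in> prop_B n 0 l u" by (simp add: prop_B_def)
  then have "skew_dist n 0 l u ?W f 0 \<le> (\<Sum>x\<in>grid n 0. ?W x * loss 0 (f x - f x))"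
    by (intro skew_dist_le) auto
  also have "\<dots> = 0" by (simp add: loss_0)
  finally have "skew_dist n 0 l u ?W f 0 \<le> 0" .
  moreover have "0 \<le> skew_dist n 0 l u ?W f s"
    using Nil by (intro skew_dist_ge sum_nonneg mult_nonneg_nonneg loss_nonneg) auto
  moreover have "d = 0" using Nil by simp
  ultimately show ?case by (simp del: prod_list_pmf.simps)
next
  case (Cons \<mu> \<mu>s)
  then obtain e where d: "d = Suc e" "length \<mu>s = e" by auto
  let ?W = "pmf (prod_list_pmf (\<mu> # \<mu>s))" and ?W' = "pmf (prod_list_pmf \<mu>s)"
  let ?V = "skew_dist n (Suc e) l u ?W"
  let ?V' = "\<lambda>a f. skew_dist n e (\<lambda>r. l (Suc r)) (\<lambda>r. u (Suc r)) ?W' (\<lambda>p. f (a # p))"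
  let ?\<delta> = "\<lambda>r. \<Sum>x\<in>grid n (Suc e). ?W x * of_bool (f x \<noteq> F r x)"
  let ?\<delta>' = "\<lambda>a r. \<Sum>p\<in>grid n e. ?W' p * of_bool (f (a # p) \<noteq> F r (a # p))"
  have bf: "bounding_family n (Suc e) l u" using Cons.prems d by simp
  note bf' = bounding_family_Suc[OF bf]
  have W: "?W (a # p) = pmf \<mu> a * ?W' p" for a p by (rule pmf_prod_list_pmf_Cons)
  have \<delta>_split: "?\<delta> r = (\<Sum>a=1..n. pmf \<mu> a * ?\<delta>' a r)" for r
    by (simp add: sum_grid_Suc W sum_distrib_left mult_ac del: prod_list_pmf.simps)
  have F0: "F 0 \<in> dim_B n (Suc e) l u 0" using Cons.prems d by simp
  have IH: "?V' a f 0 - ?V' a f s \<le> 2 * s * (\<Sum>r<e. ?\<delta>' a (Suc r))" if "a \<in> {1..n}" for a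
    using Cons.prems(3)[of "Suc r" for r] that d
    by (intro Cons.IH bf') (auto simp: dim_B_Suc_Suc)
  have slice: "?V' a (F 0) 0 - ?V' a (F 0) s \<le> s * ?\<delta>' a 0 + 2 * s * (\<Sum>r<e. ?\<delta>' a (Suc r))"
    if "a \<in> {1..n}" for a
    using skew_dist_perturb[OF bf' _ assms(3), of ?W' "\<lambda>p. F 0 (a # p)" "\<lambda>p. f (a # p)"] IH[OF that]
    by (simp add: eq_commute[of "F 0 _"])
  have "?V f 0 - ?V f s \<le> ?V (F 0) 0 - ?V (F 0) s + s * ?\<delta> 0"
    using skew_dist_perturb[OF bf _ assms(3), of ?W f "F 0"] by simp
  also have "\<dots> \<le> (\<Sum>a=1..n. pmf \<mu> a * ?V' a (F 0) 0) - (\<Sum>a=1..n. pmf \<mu> a * ?V' a (F 0) s) + s * ?\<delta> 0"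
    by (intro add_right_mono diff_mono
        skew_dist_Suc_le[where W = ?W and w = "pmf \<mu>" and W' = ?W', OF bf W _ _ F0]
        skew_dist_Suc_ge[where W = ?W and w = "pmf \<mu>" and W' = ?W', OF bf W]) auto
  also have "\<dots> = (\<Sum>a=1..n. pmf \<mu> a * (?V' a (F 0) 0 - ?V' a (F 0) s)) + s * ?\<delta> 0"
    by (simp add: right_diff_distrib sum_subtractf)
  also have "(\<Sum>a=1..n. pmf \<mu> a * (?V' a (F 0) 0 - ?V' a (F 0) s))
    \<le> (\<Sum>a=1..n. pmf \<mu> a * (s * ?\<delta>' a 0 + 2 * s * (\<Sum>r<e. ?\<delta>' a (Suc r))))"
    using slice by (intro sum_mono mult_left_mono) auto
  also have "\<dots> = s * (\<Sum>a=1..n. pmf \<mu> a * ?\<delta>' a 0)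
      + 2 * s * (\<Sum>a=1..n. \<Sum>r<e. pmf \<mu> a * ?\<delta>' a (Suc r))"
    unfolding sum_distrib_left distrib_left sum.distrib by (simp only: mult_ac)
  also have "(\<Sum>a=1..n. \<Sum>r<e. pmf \<mu> a * ?\<delta>' a (Suc r)) = (\<Sum>r<e. ?\<delta> (Suc r))"
    unfolding \<delta>_split by (rule sum.swap)
  also have "s * (\<Sum>a=1..n. pmf \<mu> a * ?\<delta>' a 0) + 2 * s * (\<Sum>r<e. ?\<delta> (Suc r)) + s * ?\<delta> 0
    = 2 * s * (\<Sum>r<Suc e. ?\<delta> r)"
    unfolding \<delta>_split[symmetric] sum.lessThan_Suc_shift by (simp add: algebra_simps)
  finally show ?case by (simp only: d)
qed

lemma close_function_exists:
  assumes "bounding_family n d l u" "length \<mu>s = d" "\<And>r. r < d \<Longrightarrow> F r \<in> dim_B n d l u r"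
  shows "\<exists>h\<in>prop_B n d l u.
    (\<Sum>x\<in>grid n d. pmf (prod_list_pmf \<mu>s) x * of_bool (f x \<noteq> h x))
    \<le> 4 * (\<Sum>r<d. \<Sum>x\<in>grid n d. pmf (prod_list_pmf \<mu>s) x * of_bool (f x \<noteq> F r x))"
proof -
  let ?X = "grid n d" and ?W = "pmf (prod_list_pmf \<mu>s)" and ?V = "skew_dist n d l u (pmf (prod_list_pmf \<mu>s)) f"
  obtain h where h: "h \<in> prop_B n d l u" "?V 0 = (\<Sum>x\<in>?X. ?W x * \<bar>h x - f x\<bar>)"
    using skew_dist_0_attained[where W = ?W and f = f, OF assms(1)] by auto
  \<comment> \<open>At most the smallest nonzero discrepancy between \<open>h\<close> and
    \<open>f\<close>; the inserted 1 keeps the set nonempty when there is none.\<close>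
  define s where "s = Min (insert 1 ((\<lambda>x. \<bar>h x - f x\<bar>) ` {x \<in> ?X. f x \<noteq> h x}))"
  have s: "0 < s" unfolding s_def by (subst Min_gr_iff) (auto simp: finite_grid)
  have gap: "s \<le> \<bar>h x - f x\<bar>" if "x \<in> ?X" "f x \<noteq> h x" for x
    unfolding s_def using that by (intro Min_le) (auto simp: finite_grid)
  \<comment> \<open>Average the candidates \<open>h\<close> and \<open>h - s\<close> for
    \<open>V(f, s)\<close>. Both are free where \<open>h = f\<close>; where \<open>h < f\<close> the
    first saves \<open>s\<close> over \<open>|h - f|\<close>, where \<open>h > f\<close> the second
    does.\<close>
  have "(\<lambda>x. h x + - s) \<in> prop_B n d l u" by (intro prop_B_add_const h(1))
  then have "2 * ?V s \<le> (\<Sum>x\<in>?X. ?W x * loss s (h x - f x)) + (\<Sum>x\<in>?X. ?W x * loss s (h x + - s - f x))"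
    using skew_dist_le[where W = ?W and f = f and s = s, OF _ h(1)]
      skew_dist_le[where W = ?W and f = f and s = s and h = "\<lambda>x. h x + - s"] by fastforce
  also have "\<dots> = (\<Sum>x\<in>?X. ?W x * (loss s (h x - f x) + loss s (h x + - s - f x)))"
    by (simp add: sum.distrib distrib_left)
  also have "\<dots> \<le> (\<Sum>x\<in>?X. ?W x * (2 * \<bar>h x - f x\<bar> - s * of_bool (f x \<noteq> h x)))"
  proof (intro sum_mono mult_left_mono)
    fix x assume "x \<in> ?X"
    then show "loss s (h x - f x) + loss s (h x + - s - f x) \<le> 2 * \<bar>h x - f x\<bar> - s * of_bool (f x \<noteq> h x)"
      using gap[of x] s by (cases "f x = h x") (auto simp: loss_def max_def abs_if split: if_splits)
  qed auto
  also have "\<dots> = 2 * ?V 0 - s * (\<Sum>x\<in>?X. ?W x * of_bool (f x \<noteq> h x))"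
    by (simp add: h(2) right_diff_distrib sum_subtractf sum_distrib_left mult_ac)
  finally have "s * (\<Sum>x\<in>?X. ?W x * of_bool (f x \<noteq> h x)) \<le> 2 * (?V 0 - ?V s)" by simp
  also have "?V 0 - ?V s \<le> 2 * s * (\<Sum>r<d. \<Sum>x\<in>?X. ?W x * of_bool (f x \<noteq> F r x))"
    using assms s by (intro skew_dist_drop_le) auto
  finally have "s * (\<Sum>x\<in>?X. ?W x * of_bool (f x \<noteq> h x))
      \<le> s * (4 * (\<Sum>r<d. \<Sum>x\<in>?X. ?W x * of_bool (f x \<noteq> F r x)))" by (simp add: mult_ac)
  then show ?thesis using s h(1) by (intro bexI[of _ h]) auto
qed

subsection \<open>Product distributions\<close>

lemma prob_sum_grid:
  assumes "set_pmf D \<subseteq> grid n d"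
  shows "measure_pmf.prob D {x. Q x} = (\<Sum>x\<in>grid n d. pmf D x * of_bool (Q x))"
proof -
  have "measure_pmf.prob D {x. Q x} = measure_pmf.prob D ({x. Q x} \<inter> grid n d)"
    using assms by (intro measure_pmf.finite_measure_eq_AE) (auto simp: AE_measure_pmf_iff)
  also have "\<dots> = (\<Sum>x\<in>{x. Q x} \<inter> grid n d. pmf D x)"
    by (rule measure_measure_pmf_finite) (simp add: finite_grid)
  also have "\<dots> = (\<Sum>x\<in>grid n d. pmf D x * of_bool (Q x))"
    by (rule sum.mono_neutral_cong_left) (auto simp: finite_grid)
  finally show ?thesis .
qed

lemma set_prod_list_pmf:
  "xs \<in> set_pmf (prod_list_pmf \<mu>s) \<Longrightarrow> length xs = length \<mu>s \<and> (\<forall>i<length \<mu>s. xs ! i \<in> set_pmf (\<mu>s ! i))"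
  by (induction \<mu>s arbitrary: xs) (auto simp: nth_Cons split: nat.split)

lemma prob_pair_pmf_Times:
  "measure_pmf.prob (pair_pmf M N) (A \<times> B) = measure_pmf.prob M A * measure_pmf.prob N B"
proof -
  have "measure_pmf.prob (pair_pmf M N) (A \<times> B)
    = measure_pmf.prob (pair_pmf M N) ((A \<inter> set_pmf M) \<times> (B \<inter> set_pmf N))"
    by (subst measure_Int_set_pmf[symmetric]) (simp add: Times_Int_Times)
  then show ?thesis
    by (simp add: measure_pmf_prob_product countable_Int2 measure_Int_set_pmf)
qed

lemma prob_prod_list_pmf:
  "measure_pmf.prob (prod_list_pmf \<mu>s) {xs. \<forall>i<length \<mu>s. P i (xs ! i)}
    = (\<Prod>i<length \<mu>s. measure_pmf.prob (\<mu>s ! i) {x. P i x})"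
proof (induction \<mu>s arbitrary: P)
  case (Cons \<mu> \<mu>s)
  have "measure_pmf.prob (prod_list_pmf (\<mu> # \<mu>s)) {xs. \<forall>i<length (\<mu> # \<mu>s). P i (xs ! i)}
    = measure_pmf.prob (pair_pmf \<mu> (prod_list_pmf \<mu>s))
        ({x. P 0 x} \<times> {xs. \<forall>i<length \<mu>s. P (Suc i) (xs ! i)})"
    unfolding prod_list_pmf_Cons measure_map_pmf
    by (auto simp: All_less_Suc2 intro!: arg_cong[where f = "measure_pmf.prob _"])
  also have "\<dots> = measure_pmf.prob \<mu> {x. P 0 x} * (\<Prod>i<length \<mu>s. measure_pmf.prob (\<mu>s ! i) {x. P (Suc i) x})"
    by (simp add: prob_pair_pmf_Times Cons.IH[of "\<lambda>i. P (Suc i)"])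
  also have "\<dots> = (\<Prod>i<length (\<mu> # \<mu>s). measure_pmf.prob ((\<mu> # \<mu>s) ! i) {x. P i x})"
    by (simp add: prod.lessThan_Suc_shift del: prod.lessThan_Suc)
  finally show ?case .
qed simp

subsection \<open>Testing a line\<close>

text \<open>The tree of depth \<open>k\<close> on the keys strictly between \<open>a\<close> and \<open>a + 2 ^ k\<close>; descending past the node of \<open>x\<close>
  itself is harmless and gives all paths the same length.\<close>

fun bst_path :: "nat \<Rightarrow> nat \<Rightarrow> nat \<Rightarrow> nat list" where
  "bst_path 0 a b = []"
| "bst_path (Suc k) a x =
     (a + 2 ^ k) # bst_path k (if x < a + 2 ^ k then a else a + 2 ^ k) x"

lemma length_bst_path [simp]: "length (bst_path k a x) = k"
  by (induction k arbitrary: a) auto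

text \<open>Both searches visit the same keys until one falls between \<open>x\<close> and
  \<open>y\<close>, endpoints included; that key is on both paths.\<close>

lemma bst_path_common:
  assumes "a < x" "x < y" "y < a + 2 ^ k"
  shows "\<exists>c\<in>set (bst_path k a x) \<inter> set (bst_path k a y). x \<le> c \<and> c \<le> y"
  using assms
proof (induction k arbitrary: a)
  case (Suc k)
  consider "y < a + 2 ^ k" | "a + 2 ^ k < x" | "x \<le> a + 2 ^ k" "a + 2 ^ k \<le> y" by linarith
  then show ?case
  proof cases
    case 1
    then show ?thesis using Suc.IH[of a] Suc.prems by auto
  next
    case 2
    then show ?thesis using Suc.IH[of "a + 2 ^ k"] Suc.prems by auto
  qed auto
qed simp

text \<open>McShane's extension for an asymmetric distance: take the largest extension that the data
  and bounds allow.\<close>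

lemma line_extension:
  fixes g l u :: "nat \<Rightarrow> real"
  assumes lu: "\<And>t. t \<in> {1..<n} \<Longrightarrow> l t \<le> u t"
    and S: "S \<subseteq> {1..n}"
    and g: "\<And>a b. a \<in> S \<Longrightarrow> b \<in> S \<Longrightarrow> a < b \<Longrightarrow> (\<Sum>t=a..<b. l t) \<le> g b - g a \<and> g b - g a \<le> (\<Sum>t=a..<b. u t)"
  shows "\<exists>e. (\<forall>a\<in>S. e a = g a) \<and> (\<forall>t\<in>{1..<n}. l t \<le> e (Suc t) - e t \<and> e (Suc t) - e t \<le> u t)"
proof (cases "S = {}")
  case True
  then show ?thesis
    using lu by (intro exI[of _ "\<lambda>x. \<Sum>t<x. u t"]) simp
next
  case False
  have fin: "finite S" using S finite_subset by blast
  \<comment> \<open>The largest change from \<open>a\<close> to \<open>x\<close> that the bounds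
    permit: upper bounds going right, negated lower bounds going left.\<close>
  define m where "m x a = (if a \<le> x then \<Sum>t=a..<x. u t else - (\<Sum>t=x..<a. l t))" for x a
  define e where "e x = Min ((\<lambda>a. g a + m x a) ` S)" for x
  have e_le: "e x \<le> g a + m x a" if "a \<in> S" for a x
    unfolding e_def using that fin by (intro Min_le) auto
  have e_attained: "\<exists>a\<in>S. e x = g a + m x a" for x
  proof -
    have "e x \<in> (\<lambda>a. g a + m x a) ` S" unfolding e_def using fin False by (intro Min_in) auto
    then show ?thesis by auto
  qed
  have m_step: "l t \<le> m (Suc t) a - m t a \<and> m (Suc t) a - m t a \<le> u t" if "t \<in> {1..<n}" for t a
  proof -
    consider "a \<le> t" | "a = Suc t" | "Suc t < a" by linarith
    then show ?thesis
      using lu[OF that] by cases (auto simp: m_def sum.atLeast_Suc_lessThan)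
  qed
  have "e a = g a" if a: "a \<in> S" for a
  proof (rule antisym)
    show "e a \<le> g a" using e_le[OF a, of a] by (simp add: m_def)
    obtain b where b: "b \<in> S" "e a = g b + m a b" using e_attained by blast
    have "g a \<le> g b + m a b"
      using g[OF a b(1)] g[OF b(1) a] by (cases a b rule: linorder_cases) (auto simp: m_def)
    then show "g a \<le> e a" using b by simp
  qed
  moreover have "l t \<le> e (Suc t) - e t \<and> e (Suc t) - e t \<le> u t" if t: "t \<in> {1..<n}" for t
  proof
    obtain a where "a \<in> S" "e (Suc t) = g a + m (Suc t) a" using e_attained by blast
    then show "l t \<le> e (Suc t) - e t" using e_le[of a t] m_step[OF t, of a] by linarith
    obtain a where "a \<in> S" "e t = g a + m t a" using e_attained by blast
    then show "e (Suc t) - e t \<le> u t" using e_le[of a "Suc t"] m_step[OF t, of a] by linarith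
  qed
  ultimately show ?thesis by blast
qed

lemma prop_B_line:
  assumes "g \<in> prop_B n d l u" "x \<in> grid n d" "r < d" "1 \<le> a" "a \<le> b" "b \<le> n"
  shows "(\<Sum>t=a..<b. l r t) \<le> g (x[r := b]) - g (x[r := a])"
    and "g (x[r := b]) - g (x[r := a]) \<le> (\<Sum>t=a..<b. u r t)"
proof -
  have len: "length x = d" using assms(2) by (simp add: grid_def)
  have "l r t \<le> g (x[r := Suc t]) - g (x[r := t]) \<and> g (x[r := Suc t]) - g (x[r := t]) \<le> u r t"
    if "t \<in> {a..<b}" for t
  proof -
    have "x[r := t] \<in> grid n d" using assms that by (auto simp: grid_def nth_list_update)
    moreover have "step (x[r := t]) r = x[r := Suc t]" using len assms(3) by (simp add: step_def)
    ultimately show ?thesis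
      using assms that len unfolding prop_B_def by (auto dest!: bspec[of _ _ "x[r := t]"])
  qed
  moreover have "g (x[r := b]) - g (x[r := a]) = (\<Sum>t=a..<b. g (x[r := Suc t]) - g (x[r := t]))"
    using sum_Suc_diff'[OF assms(5), of "\<lambda>t. g (x[r := t])"] by simp
  ultimately show "(\<Sum>t=a..<b. l r t) \<le> g (x[r := b]) - g (x[r := a])"
    and "g (x[r := b]) - g (x[r := a]) \<le> (\<Sum>t=a..<b. u r t)"
    by (auto intro!: sum_mono)
qed

text \<open>The tree has \<open>2 ^ k - 1\<close> keys, starting at 1; those beyond \<open>n\<close>
  lie off the grid and are skipped.\<close>

definition line_queries :: "nat \<Rightarrow> nat \<Rightarrow> nat \<Rightarrow> nat list \<Rightarrow> nat list list" where
  "line_queries n k r x = x # map (\<lambda>c. x[r := c]) (filter (\<lambda>c. c \<le> n) (bst_path k 0 (x ! r)))"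

text \<open>Rejecting only when no function with the property fits the answers makes the error
  one-sided.\<close>

definition consistent :: "nat \<Rightarrow> nat \<Rightarrow> (nat \<Rightarrow> nat \<Rightarrow> real) \<Rightarrow> (nat \<Rightarrow> nat \<Rightarrow> real)
    \<Rightarrow> (nat list \<Rightarrow> real) \<Rightarrow> nat list list \<Rightarrow> bool" where
  "consistent n d l u f qs \<longleftrightarrow> (\<exists>g\<in>prop_B n d l u. \<forall>q\<in>set qs. g q = f q)"

lemma length_line_queries: "length (line_queries n k r x) \<le> Suc k"
  unfolding line_queries_def using length_filter_le[of "\<lambda>c. c \<le> n" "bst_path k 0 (x ! r)"] by simp

text \<open>Both fitting functions agree with \<open>f\<close> at a shared key \<open>c\<close>
  between \<open>a\<close> and \<open>b\<close>; their bounds on the two sides of \<open>c\<close>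
  add up.\<close>

lemma consistent_line_pair:
  assumes x: "x \<in> grid n d" "r < d" and n: "n < 2 ^ k"
    and ab: "1 \<le> a" "a < b" "b \<le> n"
    and a: "consistent n d l u f (line_queries n k r (x[r := a]))"
    and b: "consistent n d l u f (line_queries n k r (x[r := b]))"
  shows "(\<Sum>t=a..<b. l r t) \<le> f (x[r := b]) - f (x[r := a]) \<and>
    f (x[r := b]) - f (x[r := a]) \<le> (\<Sum>t=a..<b. u r t)"
proof -
  have len: "length x = d" using x by (simp add: grid_def)
  obtain c where c: "c \<in> set (bst_path k 0 a)" "c \<in> set (bst_path k 0 b)" "a \<le> c" "c \<le> b"
    using bst_path_common[of 0 a b k] ab n by auto
  obtain ga where ga: "ga \<in> prop_B n d l u" "\<forall>q\<in>set (line_queries n k r (x[r := a])). ga q = f q"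
    using a by (auto simp: consistent_def)
  obtain gb where gb: "gb \<in> prop_B n d l u" "\<forall>q\<in>set (line_queries n k r (x[r := b])). gb q = f q"
    using b by (auto simp: consistent_def)
  have "ga (x[r := a]) = f (x[r := a])" "ga (x[r := c]) = f (x[r := c])"
    "gb (x[r := b]) = f (x[r := b])" "gb (x[r := c]) = f (x[r := c])"
    using ga(2) gb(2) c ab x len by (auto simp: line_queries_def)
  moreover have "(\<Sum>t=a..<b. l r t) = (\<Sum>t=a..<c. l r t) + (\<Sum>t=c..<b. l r t)"
    "(\<Sum>t=a..<b. u r t) = (\<Sum>t=a..<c. u r t) + (\<Sum>t=c..<b. u r t)"
    using c by (simp_all add: sum.atLeastLessThan_concat)
  ultimately show ?thesis
    using prop_B_line[OF ga(1) x, of a c] prop_B_line[OF gb(1) x, of c b] c ab by auto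
qed

lemma line_repair:
  assumes bf: "bounding_family n d l u" and r: "r < d" and n: "n < 2 ^ k"
  shows "\<exists>F\<in>dim_B n d l u r. \<forall>x\<in>grid n d. consistent n d l u f (line_queries n k r x) \<longrightarrow> F x = f x"
proof -
  let ?good = "\<lambda>x a. a \<in> {1..n} \<and> consistent n d l u f (line_queries n k r (x[r := a]))"
  let ?ext = "\<lambda>x e. (\<forall>a. ?good x a \<longrightarrow> e a = f (x[r := a])) \<and>
    (\<forall>t\<in>{1..<n}. l r t \<le> e (Suc t) - e t \<and> e (Suc t) - e t \<le> u r t)"
  define E where "E x = (SOME e. ?ext x e)" for x
  have E: "?ext x (E x)" if x: "x \<in> grid n d" for x
  proof -
    have "\<exists>e. (\<forall>a\<in>{a. ?good x a}. e a = f (x[r := a])) \<and>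
      (\<forall>t\<in>{1..<n}. l r t \<le> e (Suc t) - e t \<and> e (Suc t) - e t \<le> u r t)"
    proof (rule line_extension)
      show "l r t \<le> u r t" if "t \<in> {1..<n}" for t
      proof -
        have "t \<in> {1..n - 1}" using that by auto
        then show ?thesis using bf r unfolding bounding_family_def by (meson less_imp_le)
      qed
      show "{a. ?good x a} \<subseteq> {1..n}" by blast
      show "(\<Sum>t=a..<b. l r t) \<le> f (x[r := b]) - f (x[r := a]) \<and>
          f (x[r := b]) - f (x[r := a]) \<le> (\<Sum>t=a..<b. u r t)"
        if "a \<in> {a. ?good x a}" "b \<in> {a. ?good x a}" "a < b" for a b
        using that by (intro consistent_line_pair[OF x r n]) auto
    qed
    then have "\<exists>e. ?ext x e" by simp
    then show ?thesis unfolding E_def by (rule someI_ex)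
  qed
  \<comment> \<open>\<open>x[r := 1]\<close> represents the line through \<open>x\<close>, so all
    points of a line use the same extension.\<close>
  define F where "F x = E (x[r := 1]) (x ! r)" for x
  have base: "x[r := 1] \<in> grid n d" if "x \<in> grid n d" for x
  proof -
    have "1 \<le> n" using that r unfolding grid_def by (blast intro: order_trans)
    then show ?thesis using that r by (simp add: grid_def nth_list_update)
  qed
  have "F \<in> dim_B n d l u r"
    unfolding dim_B_def
  proof (intro CollectI ballI impI)
    fix x assume x: "x \<in> grid n d" "x ! r < n"
    then have "x ! r \<in> {1..<n}" "length x = d" using r by (auto simp: grid_def)
    then show "l r (x ! r) \<le> F (step x r) - F x \<and> F (step x r) - F x \<le> u r (x ! r)"
      using E[OF base[OF x(1)]] r by (simp add: F_def step_def)
  qed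
  moreover have "F x = f x" if x: "x \<in> grid n d" "consistent n d l u f (line_queries n k r x)" for x
  proof -
    have "x ! r \<in> {1..n}" using x r by (auto simp: grid_def)
    then show ?thesis using E[OF base[OF x(1)]] x(2) by (simp add: F_def)
  qed
  ultimately show ?thesis by blast
qed

subsection \<open>The tester\<close>

lemma dist_D_le:
  assumes "g \<in> P"
  shows "dist_D D f P \<le> measure_pmf.prob D {x. f x \<noteq> g x}"
  unfolding dist_D_def
  by (rule cINF_lower[OF _ assms]) (rule bdd_belowI2[of _ 0], simp)

lemma product_distribution_grid:
  assumes "product_distribution n d D"
  obtains \<mu>s where "length \<mu>s = d" "D = prod_list_pmf \<mu>s" "set_pmf D \<subseteq> grid n d"
proof -
  from assms obtain \<mu>s where \<mu>s: "length \<mu>s = d" "\<forall>i<d. set_pmf (\<mu>s ! i) \<subseteq> {1..n}" "D = prod_list_pmf \<mu>s"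
    by (auto simp: product_distribution_def)
  moreover have "set_pmf D \<subseteq> grid n d"
    using \<mu>s set_prod_list_pmf[of _ \<mu>s] by (fastforce simp: grid_def)
  ultimately show thesis using that by blast
qed

text \<open>\<open>f\<close> and its repair in direction \<open>r\<close> differ only at grid points
  failing their test; the factor 4 is that of the dimension reduction.\<close>

lemma dist_D_le_sum_inconsistent:
  assumes bf: "bounding_family n d l u" and n: "n < 2 ^ k" and D: "product_distribution n d D"
  shows "dist_D D f (prop_B n d l u)
    \<le> 4 * (\<Sum>r<d. measure_pmf.prob D {x. \<not> consistent n d l u f (line_queries n k r x)})"
proof -
  obtain \<mu>s where \<mu>s: "length \<mu>s = d" "D = prod_list_pmf \<mu>s" "set_pmf D \<subseteq> grid n d"
    using product_distribution_grid[OF D] .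
  have "\<forall>r. \<exists>F. r < d \<longrightarrow> F \<in> dim_B n d l u r \<and>
      (\<forall>x\<in>grid n d. consistent n d l u f (line_queries n k r x) \<longrightarrow> F x = f x)"
    using line_repair[OF bf _ n] by meson
  then obtain F where F: "\<And>r. r < d \<Longrightarrow> F r \<in> dim_B n d l u r"
    "\<And>r x. r < d \<Longrightarrow> x \<in> grid n d \<Longrightarrow> consistent n d l u f (line_queries n k r x) \<Longrightarrow> F r x = f x"
    using choice by metis
  obtain h where h: "h \<in> prop_B n d l u"
    "(\<Sum>x\<in>grid n d. pmf D x * of_bool (f x \<noteq> h x))
    \<le> 4 * (\<Sum>r<d. \<Sum>x\<in>grid n d. pmf D x * of_bool (f x \<noteq> F r x))"
    using close_function_exists[OF bf \<mu>s(1) F(1)] \<mu>s(2) by blast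
  have "dist_D D f (prop_B n d l u) \<le> (\<Sum>x\<in>grid n d. pmf D x * of_bool (f x \<noteq> h x))"
    using dist_D_le[OF h(1)] prob_sum_grid[OF \<mu>s(3)] by metis
  also note h(2)
  also have "(\<Sum>r<d. \<Sum>x\<in>grid n d. pmf D x * of_bool (f x \<noteq> F r x))
    \<le> (\<Sum>r<d. measure_pmf.prob D {x. \<not> consistent n d l u f (line_queries n k r x)})"
    unfolding prob_sum_grid[OF \<mu>s(3)]
    by (intro sum_mono mult_left_mono) (auto simp: of_bool_def F(2))
  finally show ?thesis by simp
qed

lemma sum_mod_eq:
  fixes p :: "nat \<Rightarrow> 'a::comm_semiring_1"
  shows "(\<Sum>i<M * d. p (i mod d)) = of_nat M * (\<Sum>r<d. p r)"
proof -
  have "(\<Sum>i=j * d..<j * d + d. p (i mod d)) = (\<Sum>r<d. p r)" for j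
    using sum.shift_bounds_nat_ivl[of "\<lambda>i. p (i mod d)" 0 "j * d" d]
    by (simp add: add.commute lessThan_atLeast0)
  then have "(\<Sum>j<M. \<Sum>i=j * d..<j * d + d. p (i mod d)) = of_nat M * (\<Sum>r<d. p r)" by simp
  then show ?thesis by (simp only: sum.nat_group)
qed

text \<open>Sample \<open>i\<close> tests direction \<open>i mod d\<close>, so each direction gets
  \<open>M\<close> independent samples; then \<open>1 - p \<le> exp (- p)\<close>.\<close>

lemma prob_all_consistent_le:
  "measure_pmf.prob (iid_pmf (M * d) D) {s. \<forall>i<M * d. P (i mod d) (s ! i)}
    \<le> exp (- real M * (\<Sum>r<d. measure_pmf.prob D {x. \<not> P r x}))"
proof -
  define p where "p r = measure_pmf.prob D {x. \<not> P r x}" for r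
  have compl: "measure_pmf.prob D {x. P r x} = 1 - p r" for r
    using measure_pmf.prob_neg[of D "P r"] by (simp add: p_def)
  have "measure_pmf.prob (iid_pmf (M * d) D) {s. \<forall>i<M * d. P (i mod d) (s ! i)}
    = (\<Prod>i<M * d. 1 - p (i mod d))"
    using prob_prod_list_pmf[of "replicate (M * d) D" "\<lambda>i. P (i mod d)"] by (simp add: iid_pmf_def compl)
  also have "\<dots> \<le> (\<Prod>i<M * d. exp (- p (i mod d)))"
  proof (rule prod_mono, intro conjI)
    show "0 \<le> 1 - p (i mod d)" for i by (simp add: p_def)
    show "1 - p (i mod d) \<le> exp (- p (i mod d))" for i
      using exp_ge_add_one_self[of "- p (i mod d)"] by simp
  qed
  also have "\<dots> = exp (- real M * (\<Sum>r<d. p r))"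
    by (simp add: exp_sum[symmetric] sum_negf sum_mod_eq)
  finally show ?thesis by (simp add: p_def)
qed

theorem theorem1p7:
  fixes n d :: nat and l u :: "nat \<Rightarrow> nat \<Rightarrow> real" and \<epsilon> :: real
  assumes "bounding_family n d l u" and "\<epsilon> > 0"
  shows "\<exists>(m::nat) (R::nat pmf) Q A.
     (\<forall>c s. real (length (Q c s)) \<le> 100 / \<epsilon> * real d * log 2 (real n)) \<and>
     real m \<le> 100 / \<epsilon> * real d * log 2 (real n) \<and>
     (\<forall>D f. product_distribution n d D \<longrightarrow>
        (f \<in> prop_B n d l u \<longrightarrow> accept_prob m R Q A D f = 1) \<and>
        (dist_D D f (prop_B n d l u) > \<epsilon> \<longrightarrow> accept_prob m R Q A D f < 1/3))"
proof (cases "\<epsilon> < 1 \<and> 2 \<le> n")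
  case False
  \<comment> \<open>No distance exceeds 1, and for \<open>n < 2\<close> there are no constraints; so
    always accepting without queries is correct.\<close>
  have not_far: "\<not> \<epsilon> < dist_D D f (prop_B n d l u)" for D f
  proof (cases "2 \<le> n")
    case True
    obtain g where "g \<in> prop_B n d l u" using prop_B_nonempty[OF assms(1)] by blast
    then have "dist_D D f (prop_B n d l u) \<le> 1"
      using dist_D_le[of g] measure_pmf.prob_le_1 order_trans by blast
    then show ?thesis using True False by simp
  next
    case False
    have "\<not> x ! r < n" if "x \<in> grid n d" "r < d" for x r
    proof -
      have "1 \<le> x ! r" using that by (simp add: grid_def)
      then show ?thesis using False by linarith
    qed
    then have "f \<in> prop_B n d l u" by (simp add: prop_B_def)
    then have "dist_D D f (prop_B n d l u) \<le> 0" using dist_D_le[of f _ D f] by simp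
    then show ?thesis using assms(2) by simp
  qed
  have "0 \<le> log 2 (real n)" by (cases "n = 0") (auto simp: log_def)
  then have "0 \<le> 100 / \<epsilon> * real d * log 2 (real n)" using assms(2) by simp
  then show ?thesis
    by (intro exI[of _ 0] exI[of _ "return_pmf 0"] exI[of _ "\<lambda>_ _. []"] exI[of _ "\<lambda>_ _ _. True"])
      (simp add: accept_prob_def not_far)
next
  case True
  let ?P = "prop_B n d l u"
  \<comment> \<open>A tree of depth \<open>j + 1\<close> holds all keys from 1 to
    \<open>n\<close>.\<close>
  obtain j where j: "2 ^ j \<le> n" "n < 2 ^ (j + 1)" using ex_power_ivl1[of 2 n] True by auto
  define k where "k = j + 1"
  \<comment> \<open>For far \<open>f\<close>, \<open>\<epsilon> < 4 * ?p\<close> below, so the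
    expected number of failing samples \<open>M * ?p\<close> is at least 2.\<close>
  define M where "M = nat \<lceil>8 / \<epsilon>\<rceil>"
  define Q where "Q s = concat (map (\<lambda>i. line_queries n k (i mod d) (s ! i)) [0..<M * d])" for s
  have log1: "1 \<le> log 2 (real n)" using True by (simp add: le_log_iff)
  have "real j \<le> log 2 (real n)" using j(1) True by (subst le_log_iff) (auto simp: powr_realpow)
  \<comment> \<open>Queries per sample: the point itself and \<open>k = j + 1\<close> keys;
    \<open>j + 2\<close> is at most three logarithms as \<open>log 2 n \<ge> 1\<close>.\<close>
  then have k: "real (Suc k) \<le> 3 * log 2 (real n)" using log1 by (simp add: k_def)
  have "real M \<le> 8 / \<epsilon> + 1" using assms(2) unfolding M_def by (simp add: of_nat_nat)
  also have "1 \<le> 1 / \<epsilon>" using True assms(2) by simp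
  finally have "real M \<le> 9 / \<epsilon>" by simp
  then have Md: "real (M * d) \<le> 9 / \<epsilon> * real d"
    unfolding of_nat_mult by (rule mult_right_mono) simp
  have M: "8 / \<epsilon> \<le> real M" unfolding M_def by linarith
  have len: "real (length (Q s)) \<le> 100 / \<epsilon> * real d * log 2 (real n)" for s
  proof -
    have "length (Q s) = (\<Sum>i<M * d. length (line_queries n k (i mod d) (s ! i)))"
      by (simp add: Q_def length_concat o_def interv_sum_list_conv_sum_set_nat lessThan_atLeast0)
    also have "\<dots> \<le> (\<Sum>i<M * d. Suc k)" by (intro sum_mono length_line_queries)
    finally have "length (Q s) \<le> (M * d) * Suc k" by simp
    then have "real (length (Q s)) \<le> real (M * d) * real (Suc k)" by (metis of_nat_le_iff of_nat_mult)
    also have "\<dots> \<le> (9 / \<epsilon> * real d) * (3 * log 2 (real n))"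
      using Md k assms(2) by (intro mult_mono) auto
    also have "\<dots> = 27 / \<epsilon> * real d * log 2 (real n)" by simp
    also have "\<dots> \<le> 100 / \<epsilon> * real d * log 2 (real n)"
      using assms(2) log1 by (intro mult_right_mono divide_right_mono) auto
    finally show ?thesis .
  qed
  have m: "real (M * d) \<le> 100 / \<epsilon> * real d * log 2 (real n)"
  proof -
    have "real (M * d) \<le> 9 / \<epsilon> * real d * 1" using Md by simp
    also have "\<dots> \<le> 100 / \<epsilon> * real d * log 2 (real n)"
      using assms(2) log1 by (intro mult_mono divide_right_mono) auto
    finally show ?thesis .
  qed
  define A where "A s ans \<longleftrightarrow> (\<exists>g\<in>?P. map g (Q s) = ans)" for s ans
  have A: "A s (map f (Q s)) \<longleftrightarrow> consistent n d l u f (Q s)" for s f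
    by (simp add: A_def consistent_def)
  have accept: "accept_prob (M * d) (return_pmf 0) (\<lambda>_. Q) (\<lambda>_. A) D f
    = measure_pmf.prob (iid_pmf (M * d) D) {s. consistent n d l u f (Q s)}" for D f
    by (simp add: accept_prob_def pair_return_pmf1 A vimage_def)
  have complete: "accept_prob (M * d) (return_pmf 0) (\<lambda>_. Q) (\<lambda>_. A) D f = 1" if "f \<in> ?P" for D f
  proof -
    have "{s. consistent n d l u f (Q s)} = UNIV" using that by (auto simp: consistent_def)
    then show ?thesis by (simp add: accept)
  qed
  have sound: "accept_prob (M * d) (return_pmf 0) (\<lambda>_. Q) (\<lambda>_. A) D f < 1/3"
    if D: "product_distribution n d D" and far: "dist_D D f ?P > \<epsilon>" for D f
  proof -
    let ?ok = "\<lambda>r x. consistent n d l u f (line_queries n k r x)"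
    let ?p = "\<Sum>r<d. measure_pmf.prob D {x. \<not> ?ok r x}"
    have "\<epsilon> < 4 * ?p"
      using dist_D_le_sum_inconsistent[OF assms(1) _ D, of k f] j far by (simp add: k_def)
    then have "8 / \<epsilon> * \<epsilon> \<le> real M * (4 * ?p)"
      using M assms(2) by (intro mult_mono) auto
    then have "2 \<le> real M * ?p" using assms(2) by simp
    have ok: "?ok (i mod d) (s ! i)" if s: "consistent n d l u f (Q s)" and i: "i < M * d" for s i
    proof -
      have "set (line_queries n k (i mod d) (s ! i)) \<subseteq> set (Q s)" using i by (auto simp: Q_def)
      then show ?thesis using s unfolding consistent_def by (meson subsetD)
    qed
    have "accept_prob (M * d) (return_pmf 0) (\<lambda>_. Q) (\<lambda>_. A) D f
      \<le> measure_pmf.prob (iid_pmf (M * d) D) {s. \<forall>i<M * d. ?ok (i mod d) (s ! i)}"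
      unfolding accept by (intro measure_pmf.finite_measure_mono) (auto intro: ok)
    also have "\<dots> \<le> exp (- real M * ?p)" by (rule prob_all_consistent_le)
    also have "\<dots> \<le> exp (- 2)" using \<open>2 \<le> real M * ?p\<close> by simp
    \<comment> \<open>The quadratic Taylor bound gives
      \<open>exp 2 \<ge> 1 + 2 + 2 = 5\<close>.\<close>
    also have "exp (- 2) < (1 / 3 :: real)"
      using exp_lower_Taylor_quadratic[of "2 :: real"] by (simp add: exp_minus field_simps)
    finally show ?thesis .
  qed
  show ?thesis
    by (intro exI[of _ "M * d"] exI[of _ "return_pmf 0"] exI[of _ "\<lambda>_. Q"] exI[of _ "\<lambda>_. A"])
      (use len m complete sound in blast)
qed

end
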